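(* Let $L$ be a non-split link that admits an alternating positive closed braid diagram. Then $L$ is a connected sum of $(2,n)$ torus links.
   Context: A positive closed braid diagram is the standard closure diagram of a braid word in positive powers of the Artin generators; it is alternating if over- and under-crossings alternate along every component. The $(2,n)$ torus link, $n\ge1$, is the closure of the 2-strand braid $\sigma_1^n$ (for $n=1$ it is the unknot). The integers $n$ may differ between summands. *)

theory Defs
  imports "HOL-Analysis.Analysis"
begin

section \<open>Links in three-space\<close>

definition self_homeomorphism :: "('a::topological_space \<Rightarrow> 'a) \<Rightarrow> bool" where
  "self_homeomorphism f \<longleftrightarrow> (\<exists>g. homeomorphism UNIV UNIV f g)"

definition ambient_isotopic :: "(real^3) set \<Rightarrow> (real^3) set \<Rightarrow> bool" where
  "ambient_isotopic K L \<longleftrightarrow>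
     (\<exists>h. homotopic_with_canon self_homeomorphism UNIV UNIV id h \<and> h ` K = L)"

text \<open>Tame means equivalent to a polygonal set. Links are unoriented and have at least one component.\<close>

definition tame :: "(real^3) set \<Rightarrow> bool" where
  "tame L \<longleftrightarrow> (\<exists>h F. self_homeomorphism h \<and> finite F \<and> h ` L = (\<Union>(a, b)\<in>F. closed_segment a b))"

definition link :: "(real^3) set \<Rightarrow> bool" where
  "link L \<longleftrightarrow> L \<noteq> {} \<and> finite (components L) \<and>
     (\<forall>C\<in>components L. C homeomorphic (sphere 0 1 :: complex set)) \<and> tame L"

definition tame_sphere :: "(real^3) set \<Rightarrow> bool" where
  "tame_sphere S \<longleftrightarrow> (\<exists>h. self_homeomorphism h \<and> S = h ` sphere 0 1)"

definition split_link :: "(real^3) set \<Rightarrow> bool" where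
  "split_link L \<longleftrightarrow>
     (\<exists>S. tame_sphere S \<and> S \<inter> L = {} \<and> L \<inter> inside S \<noteq> {} \<and> L \<inter> outside S \<noteq> {})"

text \<open>
  \<open>L\<close> is a connected sum of \<open>K1\<close> and \<open>K2\<close> if, after an isotopy, it meets a slab around the plane
  \<open>x = 0\<close> in exactly two straight segments perpendicular to that plane, and closing up its left
  and right halves by the segment \<open>sum_arc\<close> joining the two points of intersection with the plane
  yields \<open>K1\<close> and \<open>K2\<close>. The product structure in the slab guarantees that the
  decomposing sphere (the plane together with the point at infinity) meets the link transversally.
  A connected sum of links depends on the components that are joined (and, for unoriented links, on
  how they are joined), hence a relation.
\<close>

definition sum_arc :: "(real^3) set" where
  "sum_arc = closed_segment (vector [0, -1, 0]) (vector [0, 1, 0])"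

definition connected_sum :: "(real^3) set \<Rightarrow> (real^3) set \<Rightarrow> (real^3) set \<Rightarrow> bool" where
  "connected_sum K1 K2 L \<longleftrightarrow>
     (\<exists>M. ambient_isotopic L M \<and>
          {x \<in> M. \<bar>x $ 1\<bar> \<le> 1} = {x. \<bar>x $ 1\<bar> \<le> 1 \<and> \<bar>x $ 2\<bar> = 1 \<and> x $ 3 = 0} \<and>
          ambient_isotopic K1 ({x \<in> M. x $ 1 \<le> 0} \<union> sum_arc) \<and>
          ambient_isotopic K2 ({x \<in> M. x $ 1 \<ge> 0} \<union> sum_arc))"


section \<open>Positive closed braids\<close>

text \<open>
  A positive braid word on \<open>N\<close> strands is the list of the indices of its Artin generators. A word of
  length \<open>m\<close> is cut into \<open>m + 1\<close> slots: slot \<open>j < m\<close> contains the \<open>j\<close>-th letter, and slot \<open>m\<close> contains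
  the parallel strands that close the braid up. Strand positions are \<open>1, \<dots>, N\<close>.
\<close>

definition positive_braid_word :: "nat \<Rightarrow> nat list \<Rightarrow> bool" where
  "positive_braid_word N w \<longleftrightarrow> 1 \<le> N \<and> (\<forall>i\<in>set w. 1 \<le> i \<and> i < N)"

definition slot_perm :: "nat list \<Rightarrow> nat \<Rightarrow> nat \<Rightarrow> nat" where
  "slot_perm w j = (if j < length w then Transposition.transpose (w ! j) (Suc (w ! j)) else id)"

text \<open>
  How the strand entering slot \<open>j\<close> at position \<open>p\<close> behaves there: \<open>1\<close> if it moves from \<open>i\<close> to \<open>i + 1\<close>,
  which is the overpass of the crossing, \<open>-1\<close> if it moves from \<open>i + 1\<close> to \<open>i\<close>, which is the
  underpass, and \<open>0\<close> if it takes part in no crossing.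
\<close>

definition passing :: "nat list \<Rightarrow> nat \<Rightarrow> nat \<Rightarrow> int" where
  "passing w j p = int (slot_perm w j p) - int p"

text \<open>
  The closure winds counterclockwise around the \<open>z\<close>-axis, with position \<open>p\<close> at distance \<open>p\<close> from the
  axis and slot \<open>j\<close> in the \<open>j\<close>-th of \<open>m + 1\<close> equal sectors. Its projection to the \<open>xy\<close>-plane is the
  standard closure diagram, in which every crossing is positive since the
  outward moving strand is the upper one.
\<close>

definition braid_point :: "nat list \<Rightarrow> nat \<Rightarrow> nat \<Rightarrow> real \<Rightarrow> real^3" where
  "braid_point w j p t =
     (let \<theta> = 2 * pi * (real j + t) / (real (length w) + 1);
          e = real_of_int (passing w j p);
          r = real p + t * e
      in vector [r * cos \<theta>, r * sin \<theta>, e * t * (1 - t)])"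

definition closed_braid :: "nat \<Rightarrow> nat list \<Rightarrow> (real^3) set" where
  "closed_braid N w = (\<Union>j\<in>{0..length w}. \<Union>p\<in>{1..N}. braid_point w j p ` {0..1})"

definition strand_step :: "nat list \<Rightarrow> nat \<times> nat \<Rightarrow> nat \<times> nat" where
  "strand_step w = (\<lambda>(j, p). (Suc j mod Suc (length w), slot_perm w j p))"

text \<open>Following any strand from a passage through a crossing, the next passage is of the other kind.\<close>

definition alternating_closed_braid :: "nat \<Rightarrow> nat list \<Rightarrow> bool" where
  "alternating_closed_braid N w \<longleftrightarrow>
     (\<forall>j\<in>{0..length w}. \<forall>p\<in>{1..N}. \<forall>k\<ge>1.
        let pass = (\<lambda>l. case (strand_step w ^^ l) (j, p) of (j', p') \<Rightarrow> passing w j' p')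
        in pass 0 \<noteq> 0 \<and> pass k \<noteq> 0 \<and> (\<forall>l. 0 < l \<and> l < k \<longrightarrow> pass l = 0)
           \<longrightarrow> pass k = - pass 0)"

definition admits_alternating_positive_closed_braid_diagram :: "(real^3) set \<Rightarrow> bool" where
  "admits_alternating_positive_closed_braid_diagram L \<longleftrightarrow>
     (\<exists>N w. positive_braid_word N w \<and> alternating_closed_braid N w \<and>
            ambient_isotopic L (closed_braid N w))"


section \<open>Connected sums of torus links\<close>

definition torus_link_2 :: "nat \<Rightarrow> (real^3) set" where
  "torus_link_2 n = closed_braid 2 (replicate n 1)"

inductive connected_sum_of_torus_links_2 :: "(real^3) set \<Rightarrow> bool" where
  torus: "1 \<le> n \<Longrightarrow> ambient_isotopic L (torus_link_2 n) \<Longrightarrow> connected_sum_of_torus_links_2 L"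
| sum: "connected_sum_of_torus_links_2 K1 \<Longrightarrow> connected_sum_of_torus_links_2 K2 \<Longrightarrow>
        connected_sum K1 K2 L \<Longrightarrow> connected_sum_of_torus_links_2 L"

end

theory Submission
  imports Defs
begin

text \<open>
  In a positive braid the strand moving outward is always the upper one. A strand that has passed over
  at \<open>\<sigma>\<^sub>g\<close> is at position \<open>g + 1\<close>, and if its next crossing were \<open>\<sigma>\<^sub>g\<^sub>+\<^sub>1\<close> it would pass over again. Hence
  an alternating word never contains two neighbouring generators. If a generator \<open>\<sigma>\<^sub>g\<close> is missing, the
  round sphere of radius \<open>g + 1/2\<close> splits the closure. So a non-split closure has one strand and no
  crossing, or it is the closure of \<open>\<sigma>\<^sub>1\<^sup>n\<close> with \<open>n \<ge> 1\<close>; no proper connected sum occurs. The one-strand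
  closure is a round circle, and it remains to isotope the circle to the closure of \<open>\<sigma>\<^sub>1\<close>, that is, to
  undo a kink. Four shears, each changing one coordinate, do this.
\<close>

section \<open>Ambient isotopies by shears\<close>

text \<open>The second isotopy, precomposed with the end map \<open>f\<close> of the first, starts
  at \<open>f\<close> and still runs through homeomorphisms, so the two can be concatenated.\<close>

lemma ambient_isotopic_trans:
  assumes "ambient_isotopic K L" "ambient_isotopic L M"
  shows "ambient_isotopic K M"
proof -
  obtain f where f: "homotopic_with_canon self_homeomorphism UNIV UNIV id f" "f ` K = L"
    using assms(1) unfolding ambient_isotopic_def by blast
  obtain g where g: "homotopic_with_canon self_homeomorphism UNIV UNIV id g" "g ` L = M"
    using assms(2) unfolding ambient_isotopic_def by blast
  have "self_homeomorphism f" "continuous_on UNIV f"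
    using homotopic_with_imp_property[OF f(1)] homotopic_with_imp_continuous[OF f(1)] by auto
  then have "homotopic_with_canon self_homeomorphism UNIV UNIV (id \<circ> f) (g \<circ> f)"
    by (intro homotopic_with_compose_continuous_map_right[OF g(1)])
       (auto simp: self_homeomorphism_def intro: homeomorphism_compose)
  then have "homotopic_with_canon self_homeomorphism UNIV UNIV id (g \<circ> f)"
    using f(1) homotopic_with_trans by fastforce
  then show ?thesis
    using f(2) g(2) unfolding ambient_isotopic_def by (metis image_comp)
qed

text \<open>Precomposing the isotopy from \<open>id\<close> to \<open>f\<close> with the inverse
  \<open>g\<close> gives an isotopy from \<open>g\<close> to \<open>id\<close>, which is then
  reversed.\<close>

lemma ambient_isotopic_sym:
  assumes "ambient_isotopic K L"
  shows "ambient_isotopic L K"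
proof -
  obtain f where f: "homotopic_with_canon self_homeomorphism UNIV UNIV id f" "f ` K = L"
    using assms unfolding ambient_isotopic_def by blast
  obtain g where g: "homeomorphism UNIV UNIV f g"
    using homotopic_with_imp_property[OF f(1)] unfolding self_homeomorphism_def by blast
  have "homotopic_with_canon self_homeomorphism UNIV UNIV (id \<circ> g) (f \<circ> g)"
    using homeomorphism_compose[OF homeomorphism_symD[OF g]] homeomorphism_cont2[OF g]
    by (intro homotopic_with_compose_continuous_map_right[OF f(1)])
       (auto simp: self_homeomorphism_def)
  moreover have "f \<circ> g = id"
    using g by (auto simp: homeomorphism_def)
  ultimately have "homotopic_with_canon self_homeomorphism UNIV UNIV id g"
    by (simp add: homotopic_with_sym)
  moreover have "g ` L = K"
    using g f(2) by (force simp: homeomorphism_def image_image)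
  ultimately show ?thesis
    unfolding ambient_isotopic_def by blast
qed

text \<open>A continuous map from a compact set to a Hausdorff space is closed, hence a quotient map
  onto its image; \<open>q\<close> is constant on the fibres of \<open>p\<close> and therefore
  descends.\<close>

lemma continuous_factorization:
  fixes p :: "'a::t2_space \<Rightarrow> 'b::t2_space" and q :: "'a \<Rightarrow> 'c::t2_space"
  assumes "compact S" "continuous_on S p" "continuous_on S q"
    and eq: "\<And>s s'. s \<in> S \<Longrightarrow> s' \<in> S \<Longrightarrow> p s = p s' \<Longrightarrow> q s = q s'"
  obtains F where "continuous_on (p ` S) F" "\<And>s. s \<in> S \<Longrightarrow> F (p s) = q s"
proof
  define F where "F = q \<circ> inv_into S p"
  show F: "F (p s) = q s" if "s \<in> S" for s
    unfolding F_def o_def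
    by (rule eq) (use that in \<open>auto simp: inv_into_into f_inv_into_f\<close>)
  have "closed (F -` B \<inter> p ` S)" if "closed B" for B
  proof -
    have "F -` B \<inter> p ` S = p ` (q -` B \<inter> S)"
      using F by auto
    moreover have "compact (q -` B \<inter> S)"
      using assms(1,3) that
      by (metis compact_Int_closed compact_imp_closed continuous_on_closed_vimage inf.left_idem inf_commute)
    ultimately show ?thesis
      using assms(2)
      by (metis Int_lower2 compact_continuous_image compact_imp_closed continuous_on_subset)
  qed
  moreover have "closed (p ` S)"
    using assms(1,2) by (intro compact_imp_closed compact_continuous_image)
  ultimately show "continuous_on (p ` S) F"
    by (simp add: continuous_on_closed_vimage)
qed

text \<open>Since \<open>F\<close> is constant along the \<open>k\<close>-axis, the shear by
  \<open>t * F x\<close> is undone by the shear by \<open>- t * F x\<close>, so every stage is a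
  homeomorphism.\<close>

lemma ambient_isotopic_shear:
  fixes F :: "real^3 \<Rightarrow> real"
  assumes F: "continuous_on UNIV F" "\<And>x c. F (x + c *\<^sub>R axis k 1) = F x"
  shows "ambient_isotopic K ((\<lambda>x. x + F x *\<^sub>R axis k 1) ` K)"
proof -
  define h where "h = (\<lambda>(t, x). x + (t * F x) *\<^sub>R axis k (1::real))"
  have "continuous_on UNIV h"
    unfolding h_def split_def
    by (intro continuous_intros continuous_on_compose2[OF F(1)]) auto
  moreover have "self_homeomorphism (\<lambda>x. h (t, x))" for t
    unfolding self_homeomorphism_def
  proof
    show "homeomorphism UNIV UNIV (\<lambda>x. h (t, x)) (\<lambda>x. h (-t, x))"
      using F(1) unfolding h_def split_def
      by (intro homeomorphismI)
         (auto intro!: continuous_intros simp: F(2) scaleR_left_distrib[symmetric]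
           simp flip: scaleR_minus_left)
  qed
  moreover have "continuous_map (prod_topology (top_of_set {0..1}) (top_of_set UNIV)) (top_of_set UNIV) h"
    unfolding prod_topology_subtopology_eu
    using \<open>continuous_on UNIV h\<close> by (auto intro: continuous_on_subset)
  ultimately have "homotopic_with_canon self_homeomorphism UNIV UNIV id (\<lambda>x. h (1, x))"
    unfolding homotopic_with_def by (intro exI[of _ h]) (auto simp: h_def)
  then show ?thesis
    unfolding ambient_isotopic_def h_def by auto
qed

text \<open>
  The factorization defines the amount of the shear on the image of the projection along the
  \<open>k\<close>-axis, and Tietze's theorem extends it to the whole space.
\<close>

lemma ambient_isotopic_change_coordinate:
  fixes \<gamma> \<delta> :: "'a::t2_space \<Rightarrow> real^3"
  assumes S: "compact S" "continuous_on S \<gamma>" "continuous_on S \<delta>"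
    and other: "\<And>s i. s \<in> S \<Longrightarrow> i \<noteq> k \<Longrightarrow> \<delta> s $ i = \<gamma> s $ i"
    and eq: "\<And>s s'. s \<in> S \<Longrightarrow> s' \<in> S \<Longrightarrow> (\<And>i. i \<noteq> k \<Longrightarrow> \<gamma> s $ i = \<gamma> s' $ i)
               \<Longrightarrow> \<delta> s $ k - \<gamma> s $ k = \<delta> s' $ k - \<gamma> s' $ k"
  shows "ambient_isotopic (\<gamma> ` S) (\<delta> ` S)"
proof -
  define \<pi> where "\<pi> = (\<lambda>x::real^3. x - (x $ k) *\<^sub>R axis k 1)"
  have \<pi>: "\<pi> x $ i = (if i = k then 0 else x $ i)" for x i
    by (simp add: \<pi>_def axis_def)
  have cont\<pi>: "continuous_on A \<pi>" for A
    unfolding \<pi>_def by (intro continuous_intros)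
  have cont: "continuous_on S (\<pi> \<circ> \<gamma>)"
    using S(2) cont\<pi> by (intro continuous_on_compose)
  have "\<delta> s $ k - \<gamma> s $ k = \<delta> s' $ k - \<gamma> s' $ k"
    if "s \<in> S" "s' \<in> S" "(\<pi> \<circ> \<gamma>) s = (\<pi> \<circ> \<gamma>) s'" for s s'
    using that \<pi> by (intro eq) (auto simp: vec_eq_iff split: if_splits)
  moreover have "continuous_on S (\<lambda>s. \<delta> s $ k - \<gamma> s $ k)"
    using S(2,3) by (intro continuous_intros)
  ultimately obtain F where F: "continuous_on ((\<pi> \<circ> \<gamma>) ` S) F"
      "\<And>s. s \<in> S \<Longrightarrow> F ((\<pi> \<circ> \<gamma>) s) = \<delta> s $ k - \<gamma> s $ k"
    using continuous_factorization[OF S(1) cont, of "\<lambda>s. \<delta> s $ k - \<gamma> s $ k"] by blast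
  have "closed ((\<pi> \<circ> \<gamma>) ` S)"
    using cont S(1) by (intro compact_imp_closed compact_continuous_image)
  then obtain G where G: "continuous_on UNIV G" "\<And>x. x \<in> (\<pi> \<circ> \<gamma>) ` S \<Longrightarrow> G x = F x"
    using Tietze_unbounded[OF F(1), of UNIV] by auto
  \<comment> \<open>The Tietze extension \<open>G\<close> may vary along the \<open>k\<close>-axis;
    composing it with the projection \<open>\<pi>\<close> removes this dependence.\<close>
  have "ambient_isotopic (\<gamma> ` S) ((\<lambda>x. x + G (\<pi> x) *\<^sub>R axis k 1) ` \<gamma> ` S)"
  proof (rule ambient_isotopic_shear)
    show "continuous_on UNIV (\<lambda>x. G (\<pi> x))"
      by (rule continuous_on_compose2[OF G(1) cont\<pi>]) simp
    show "G (\<pi> (x + c *\<^sub>R axis k 1)) = G (\<pi> x)" for x c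
      by (rule arg_cong[where f = G]) (simp add: vec_eq_iff \<pi> axis_def)
  qed
  moreover have "(\<lambda>x. x + G (\<pi> x) *\<^sub>R axis k 1) ` \<gamma> ` S = \<delta> ` S"
    unfolding image_image
  proof (rule image_cong[OF refl])
    fix s assume "s \<in> S"
    then have "G (\<pi> (\<gamma> s)) = \<delta> s $ k - \<gamma> s $ k"
      using F(2) G(2) by force
    then show "\<gamma> s + G (\<pi> (\<gamma> s)) *\<^sub>R axis k 1 = \<delta> s"
      using other[OF \<open>s \<in> S\<close>] by (auto simp: vec_eq_iff axis_def)
  qed
  ultimately show ?thesis
    by simp
qed

section \<open>Splitting spheres\<close>

text \<open>The closure of a bounded set is compact. Applied to a homeomorphism and its inverse,
  this shows that boundedness is preserved in both directions.\<close>

lemma bounded_image_if_continuous_UNIV: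
  fixes f :: "'a::heine_borel \<Rightarrow> 'b::metric_space"
  assumes "continuous_on UNIV f" "bounded B"
  shows "bounded (f ` B)"
proof -
  have "compact (f ` closure B)"
    using assms by (intro compact_continuous_image) (auto intro: continuous_on_subset)
  then show ?thesis
    by (rule bounded_subset[OF compact_imp_bounded]) (simp add: closure_subset image_mono)
qed

text \<open>A homeomorphism of the whole space carries components of the complement to components of
  the complement and preserves their boundedness, which is what tells inside from outside.\<close>

lemma homeomorphism_inside_outside_iff:
  fixes f :: "'a::{real_normed_vector,heine_borel} \<Rightarrow> 'a"
  assumes "homeomorphism UNIV UNIV f g"
  shows "f x \<in> inside (f ` S) \<longleftrightarrow> x \<in> inside S" "f x \<in> outside (f ` S) \<longleftrightarrow> x \<in> outside S"
proof -
  have inj: "inj f" and surj: "surj f"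
    using assms unfolding homeomorphism_def by (metis UNIV_I inj_on_def, blast)
  have cont: "continuous_on UNIV f" "continuous_on UNIV g"
    using assms unfolding homeomorphism_def by auto
  have gf: "g ` f ` A = A" for A
    using assms unfolding homeomorphism_def by (force simp: image_image)
  have bdd: "bounded (f ` A) \<longleftrightarrow> bounded A" for A
    using bounded_image_if_continuous_UNIV cont gf by metis
  have "homeomorphism (- S) (- f ` S) f g"
    by (rule homeomorphism_of_subsets[OF assms]) (use inj surj in \<open>auto simp: bij_image_Compl_eq bij_def\<close>)
  then have "connected_component_set (- f ` S) (f x) = f ` connected_component_set (- S) x" if "x \<notin> S"
    using connected_component_set_homeomorphism that by fast
  then show "f x \<in> inside (f ` S) \<longleftrightarrow> x \<in> inside S" "f x \<in> outside (f ` S) \<longleftrightarrow> x \<in> outside S"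
    using bdd inj by (auto simp: inside_def outside_def inj_image_mem_iff)
qed

text \<open>The end homeomorphism of the isotopy carries a splitting sphere of \<open>K\<close> to
  one of \<open>L\<close>.\<close>

lemma split_link_ambient_isotopic:
  assumes "ambient_isotopic K L" "split_link K"
  shows "split_link L"
proof -
  obtain f where f: "homotopic_with_canon self_homeomorphism UNIV UNIV id f" "f ` K = L"
    using assms(1) unfolding ambient_isotopic_def by blast
  obtain g where g: "homeomorphism UNIV UNIV f g"
    using homotopic_with_imp_property[OF f(1)] unfolding self_homeomorphism_def by blast
  obtain S where S: "tame_sphere S" "S \<inter> K = {}" "K \<inter> inside S \<noteq> {}" "K \<inter> outside S \<noteq> {}"
    using assms(2) unfolding split_link_def by blast
  obtain h h' :: "real^3 \<Rightarrow> real^3" where h: "homeomorphism UNIV UNIV h h'" "S = h ` sphere 0 1"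
    using S(1) unfolding tame_sphere_def self_homeomorphism_def by blast
  have "f ` S = (f \<circ> h) ` sphere 0 1"
    using h(2) by (simp add: image_comp)
  then have "tame_sphere (f ` S)"
    using homeomorphism_compose[OF h(1) g] unfolding tame_sphere_def self_homeomorphism_def by blast
  moreover have "f ` S \<inter> L = {}"
    using S(2) image_Int[OF inj_on_inverseI[of UNIV g f], of S K] homeomorphism_apply1[OF g]
    unfolding f(2)[symmetric] by simp
  moreover have "L \<inter> inside (f ` S) \<noteq> {}" "L \<inter> outside (f ` S) \<noteq> {}"
    using S(3,4) f(2) homeomorphism_inside_outside_iff[OF g] by blast+
  ultimately show ?thesis
    unfolding split_link_def by blast
qed

lemma tame_sphere_round:
  assumes "0 < r"
  shows "tame_sphere (sphere 0 r)"
proof -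
  have "homeomorphism UNIV UNIV (\<lambda>x::real^3. r *\<^sub>R x) (\<lambda>x. inverse r *\<^sub>R x)"
    using assms by (intro homeomorphismI) (auto intro!: continuous_intros)
  moreover have "sphere 0 r = (\<lambda>x::real^3. r *\<^sub>R x) ` sphere 0 1"
    using assms by (simp add: sphere_scale)
  ultimately show ?thesis
    unfolding tame_sphere_def self_homeomorphism_def by blast
qed

section \<open>Closures of words that miss a generator\<close>

text \<open>Only the letter \<open>g\<close> exchanges positions \<open>g\<close> and
  \<open>g + 1\<close>; without it, every strand stays on its side of the gap between them.\<close>

lemma slot_perm_le_gap:
  assumes "g \<notin> set w" "p \<le> g"
  shows "slot_perm w j p \<le> g"
proof (cases "j < length w")
  case True
  then have "w ! j \<noteq> g"
    using assms(1) nth_mem by blast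
  then show ?thesis
    using assms(2) by (auto simp: slot_perm_def Transposition.transpose_def)
qed (use assms in \<open>auto simp: slot_perm_def\<close>)

lemma slot_perm_gt_gap:
  assumes "g \<notin> set w" "g < p"
  shows "g < slot_perm w j p"
proof (cases "j < length w")
  case True
  then have "w ! j \<noteq> g"
    using assms(1) nth_mem by blast
  then show ?thesis
    using assms(2) by (auto simp: slot_perm_def Transposition.transpose_def)
qed (use assms in \<open>auto simp: slot_perm_def\<close>)

lemma abs_passing_le_1: "\<bar>passing w j p\<bar> \<le> 1"
  by (auto simp: passing_def slot_perm_def Transposition.transpose_def)

text \<open>In cylindrical coordinates the distance from the axis interpolates linearly between the
  positions at the two ends of the slot.\<close>

lemma norm_braid_point:
  "(norm (braid_point w j p t))\<^sup>2 =
     ((1 - t) * real p + t * real (slot_perm w j p))\<^sup>2 + (real_of_int (passing w j p) * t * (1 - t))\<^sup>2"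
proof -
  define r where "r = (1 - t) * real p + t * real (slot_perm w j p)"
  define \<theta> where "\<theta> = 2 * pi * (real j + t) / (real (length w) + 1)"
  have r: "real p + t * real_of_int (passing w j p) = r"
    by (simp add: r_def passing_def algebra_simps)
  have "(r * cos \<theta>)\<^sup>2 + (r * sin \<theta>)\<^sup>2 = r\<^sup>2"
    by (simp add: power_mult_distrib flip: distrib_left)
  then show ?thesis
    unfolding braid_point_def Let_def \<theta>_def[symmetric] r power2_norm_eq_inner r_def[symmetric]
    by (simp add: inner_vec_def sum_3 vector_3 power2_eq_square)
qed

text \<open>The distance from the axis is at most \<open>g\<close> and the height at most 1/4 in
  absolute value, and \<open>g\<^sup>2 + 1/16 < (g + 1/2)\<^sup>2\<close>.\<close>

lemma norm_braid_point_inside_gap: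
  assumes "g \<notin> set w" "p \<le> g" "t \<in> {0..1}"
  shows "norm (braid_point w j p t) < real g + 1 / 2"
proof -
  define r where "r = (1 - t) * real p + t * real (slot_perm w j p)"
  define z where "z = real_of_int (passing w j p) * t * (1 - t)"
  have "r \<le> real g"
    unfolding r_def using assms slot_perm_le_gap[OF assms(1,2)] by (intro convex_bound_le) auto
  moreover have "0 \<le> r"
    using assms(3) by (simp add: r_def)
  ultimately have "r\<^sup>2 \<le> (real g)\<^sup>2"
    by (rule power_mono)
  moreover have "t * (1 - t) \<le> 1 / 4"
    using zero_le_power2[of "t - 1 / 2"] by (simp add: power2_eq_square field_simps)
  then have "\<bar>z\<bar> \<le> 1 * (1 / 4)"
    unfolding z_def abs_mult mult.assoc using assms(3) abs_passing_le_1[of w j p]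
    by (intro mult_mono) auto
  then have "\<bar>z\<bar>\<^sup>2 \<le> (1 / 4)\<^sup>2"
    by (intro power_mono) auto
  ultimately have "(norm (braid_point w j p t))\<^sup>2 < (real g + 1 / 2)\<^sup>2"
    unfolding norm_braid_point r_def[symmetric] z_def[symmetric]
    by (simp add: power2_eq_square algebra_simps)
  then show ?thesis
    by (rule power2_less_imp_less) simp
qed

text \<open>The distance from the axis is already at least \<open>g + 1\<close>.\<close>

lemma norm_braid_point_outside_gap:
  assumes "g \<notin> set w" "g < p" "t \<in> {0..1}"
  shows "real g + 1 / 2 < norm (braid_point w j p t)"
proof -
  define r where "r = (1 - t) * real p + t * real (slot_perm w j p)"
  have "(1 - t) * (real g + 1) + t * (real g + 1) \<le> r"
    unfolding r_def using assms slot_perm_gt_gap[OF assms(1,2), of j]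
    by (intro add_mono mult_left_mono) auto
  then have "(real g + 1)\<^sup>2 \<le> r\<^sup>2"
    by (intro power_mono) (auto simp: algebra_simps)
  also have "\<dots> \<le> (norm (braid_point w j p t))\<^sup>2"
    unfolding norm_braid_point r_def[symmetric] by simp
  finally have "real g + 1 \<le> norm (braid_point w j p t)"
    by (rule power2_le_imp_le) simp
  then show ?thesis
    by simp
qed

text \<open>The sphere of radius \<open>g + 1/2\<close> passes through the gap; the strands starting
  at positions \<open>1\<close> and \<open>N\<close> show that the closure has points on both
  sides.\<close>

lemma split_link_closed_braid:
  assumes "1 \<le> g" "g < N" "g \<notin> set w"
  shows "split_link (closed_braid N w)"
proof -
  define S where "S = sphere (0::real^3) (real g + 1 / 2)"
  have S: "S = frontier (cball 0 (real g + 1 / 2))"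
    by (simp add: S_def)
  have inside: "inside S = ball 0 (real g + 1 / 2)"
    unfolding S by (subst inside_frontier_eq_interior) auto
  have outside: "outside S = - cball 0 (real g + 1 / 2)"
    unfolding S by (subst outside_frontier_eq_complement_closure) auto
  have mem: "braid_point w 0 p 0 \<in> closed_braid N w" if "p \<in> {1..N}" for p
    using that unfolding closed_braid_def by (force simp: image_iff)
  have "tame_sphere S"
    unfolding S_def by (rule tame_sphere_round) auto
  moreover have "S \<inter> closed_braid N w = {}"
  proof -
    have "norm (braid_point w j p t) \<noteq> real g + 1 / 2" if "t \<in> {0..1}" for j p t
      using norm_braid_point_inside_gap[OF assms(3) _ that] norm_braid_point_outside_gap[OF assms(3) _ that]
      by (metis not_le order_less_irrefl)
    then show ?thesis
      by (force simp: S_def closed_braid_def)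
  qed
  moreover have "braid_point w 0 1 0 \<in> closed_braid N w \<inter> inside S"
    using norm_braid_point_inside_gap[OF assms(3,1), of 0 0] mem[of 1] assms(1,2)
    by (simp add: inside)
  moreover have "braid_point w 0 N 0 \<in> closed_braid N w \<inter> outside S"
    using norm_braid_point_outside_gap[OF assms(3,2), of 0 0] mem[of N] assms(1,2)
    by (simp add: outside)
  ultimately show ?thesis
    unfolding split_link_def by blast
qed

section \<open>Neighbouring letters in alternating words\<close>

text \<open>
  The strand that leaves a crossing \<open>\<sigma>\<^sub>g\<close> by the overpass stays at position \<open>g + 1\<close> until the next
  letter \<open>g\<close> or \<open>g + 1\<close> of the cyclic word. If that letter were \<open>g + 1\<close>, it would pass over again.
\<close>

lemma alternating_not_both_adjacent_letters:
  assumes "positive_braid_word N w" "alternating_closed_braid N w" "g \<in> set w"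
  shows "Suc g \<notin> set w"
proof
  assume "Suc g \<in> set w"
  \<comment> \<open>A time \<open>q\<close> is read modulo the number \<open>m\<close> of slots, one
    more than the number of letters, so that \<open>occ\<close> describes the cyclic word
    unrolled.\<close>
  define m where "m = Suc (length w)"
  define occ where "occ = (\<lambda>i q. q mod m < length w \<and> w ! (q mod m) = i)"
  obtain j0 where j0: "j0 < length w" "w ! j0 = g"
    using assms(3) by (auto simp: in_set_conv_nth)
  obtain j1 where j1: "j1 < length w" "w ! j1 = Suc g"
    using \<open>Suc g \<in> set w\<close> by (auto simp: in_set_conv_nth)
  \<comment> \<open>Going one full turn beyond \<open>j1\<close> guarantees an earlier letter
    \<open>g\<close>. With \<open>a\<close> the last such time before \<open>j1 + m\<close> and
    \<open>b\<close> the first later time of \<open>g + 1\<close>, neither letter occurs strictly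
    between \<open>a\<close> and \<open>b\<close>.\<close>
  define a where "a = (GREATEST q. q < j1 + m \<and> occ g q)"
  have *: "j0 < j1 + m \<and> occ g j0"
    using j0 by (auto simp: occ_def m_def)
  have a: "a < j1 + m" "occ g a"
    using GreatestI_nat[of "\<lambda>q. q < j1 + m \<and> occ g q" j0 "j1 + m"] * by (auto simp: a_def)
  have a_max: "\<not> occ g q" if "a < q" "q < j1 + m" for q
    using Greatest_le_nat[of "\<lambda>q. q < j1 + m \<and> occ g q" q "j1 + m"] that by (auto simp: a_def)
  define b where "b = (LEAST q. a < q \<and> occ (Suc g) q)"
  have **: "a < j1 + m \<and> occ (Suc g) (j1 + m)"
  proof -
    have "(j1 + m) mod m = j1"
      using j1(1) unfolding mod_add_self2 by (simp add: m_def)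
    then show ?thesis
      using a(1) j1 by (simp add: occ_def)
  qed
  have b: "a < b" "occ (Suc g) b" "b \<le> j1 + m"
    using LeastI[of "\<lambda>q. a < q \<and> occ (Suc g) q", OF **]
      Least_le[of "\<lambda>q. a < q \<and> occ (Suc g) q", OF **] by (auto simp: b_def)
  have b_min: "\<not> occ (Suc g) q" if "a < q" "q < b" for q
    using not_less_Least[of q "\<lambda>q. a < q \<and> occ (Suc g) q"] that by (auto simp: b_def)
  have idle: "slot_perm w (q mod m) (Suc g) = Suc g" if "a < q" "q < b" for q
    using a_max[of q] b_min[OF that] that b(3)
    by (auto simp: occ_def slot_perm_def Transposition.transpose_def)
  have start: "slot_perm w (a mod m) g = Suc g"
    using a(2) by (auto simp: occ_def slot_perm_def)
  have path: "(strand_step w ^^ l) (a mod m, g) = ((a + l) mod m, Suc g)" if "1 \<le> l" "l \<le> b - a" for l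
    using that
  proof (induction l rule: dec_induct)
    case base
    then show ?case
      using start by (simp add: strand_step_def m_def mod_Suc_eq)
  next
    case (step l)
    then show ?case
      using idle[of "a + l"] by (simp add: strand_step_def m_def mod_Suc_eq)
  qed
  have "passing w (a mod m) g = 1"
    using start by (simp add: passing_def)
  moreover have "passing w (b mod m) (Suc g) = 1"
    using b(2) by (auto simp: occ_def passing_def slot_perm_def)
  moreover have "passing w ((a + l) mod m) (Suc g) = 0" if "0 < l" "l < b - a" for l
    using idle[of "a + l"] that by (simp add: passing_def)
  moreover have "g \<in> {1..N}"
    using assms(1,3) by (auto simp: positive_braid_word_def)
  moreover have "a mod m \<in> {0..length w}"
    using mod_less_divisor[of m a] by (simp add: m_def)
  \<comment> \<open>The strand passes over at \<open>a\<close> and again at \<open>b\<close>, with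
    no passage between: alternation with \<open>k = b - a\<close> would give
    \<open>1 = - 1\<close>.\<close>
  ultimately show False
    using assms(2)[unfolded alternating_closed_braid_def, rule_format, of "a mod m" g "b - a"] b(1) path
    by (auto simp: Let_def Suc_le_eq)
qed

section \<open>Removing the kink from the closure of \<open>\<sigma>\<^sub>1\<close>\<close>

text \<open>
  The closure of \<open>\<sigma>\<^sub>1\<close> is symmetric under the half turn about the \<open>y\<close>-axis. Its points are
  \<open>(e r sin \<psi>, r cos \<psi>, e z)\<close> with a sign \<open>e\<close> and \<open>\<psi> \<in> [-\<pi>, \<pi>]\<close>, where \<open>\<psi>\<close> is measured from the
  \<open>y\<close>-axis and the two halves \<open>e = 1\<close> and \<open>e = -1\<close> share their end points. The part \<open>\<bar>\<psi>\<bar> \<le> \<pi>/2\<close> of a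
  half is a strand of the crossing.
\<close>

definition kink_param :: "real \<Rightarrow> real" where
  "kink_param \<psi> = max (- 1) (min 1 (2 * \<psi> / pi))"

text \<open>On the inner strand of the crossing, \<open>t = (1 - u) / 2\<close> with
  \<open>u\<close> the value of \<open>kink_param\<close>, so the radius \<open>1 + t\<close> is
  \<open>(3 - u) / 2\<close> and the height \<open>t * (1 - t)\<close> is
  \<open>(1 - u\<^sup>2) / 4\<close>. The clamped values \<open>u = 1\<close> and
  \<open>u = - 1\<close> give the parallel arcs of radius 1 and 2.\<close>

definition kink_radius :: "real \<Rightarrow> real" where
  "kink_radius \<psi> = (3 - kink_param \<psi>) / 2"

text \<open>
  The heights after the first shear: the half \<open>e = 1\<close> moves above the plane \<open>z = 0\<close> and the other
  half below it, so that the projection along the \<open>x\<close>-axis has no crossing. The slopes \<open>1/10\<close> and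
  \<open>1/2\<close> make the height strictly decreasing on \<open>[-\<pi>/2, \<pi>]\<close>.
\<close>

definition kink_height :: "real \<Rightarrow> real" where
  "kink_height \<psi> = (1 - (kink_param \<psi>)\<^sup>2) / 4 + sin \<psi> * min (kink_param \<psi> / 10) (kink_param \<psi> / 2)"

lemma kink_param_ge: "pi / 2 \<le> \<psi> \<Longrightarrow> kink_param \<psi> = 1"
  and kink_param_le: "\<psi> \<le> - pi / 2 \<Longrightarrow> kink_param \<psi> = - 1"
  and kink_param_mid: "\<bar>\<psi>\<bar> \<le> pi / 2 \<Longrightarrow> kink_param \<psi> = 2 * \<psi> / pi"
  using pi_ge_two by (auto simp: kink_param_def max_def min_def field_simps abs_le_iff)

lemma kink_radius_pos: "0 < kink_radius \<psi>"
proof -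
  have "kink_param \<psi> \<le> 1"
    by (simp add: kink_param_def)
  then show ?thesis
    by (simp add: kink_radius_def)
qed

lemma continuous_on_kink_param: "continuous_on A kink_param"
  unfolding kink_param_def by (intro continuous_intros) auto

lemma continuous_on_kink_height: "continuous_on A kink_height"
  unfolding kink_height_def by (intro continuous_intros continuous_on_kink_param) auto

lemma kink_height_nonneg_param:
  "0 \<le> kink_param \<psi> \<Longrightarrow> kink_height \<psi> = (1 - (kink_param \<psi>)\<^sup>2) / 4 + kink_param \<psi> * sin \<psi> / 10"
  and kink_height_nonpos_param:
  "kink_param \<psi> \<le> 0 \<Longrightarrow> kink_height \<psi> = (1 - (kink_param \<psi>)\<^sup>2) / 4 + kink_param \<psi> * sin \<psi> / 2"
  by (simp_all add: kink_height_def min_absorb1 min_absorb2)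

section \<open>Monotonicity and positivity of the height\<close>

text \<open>By concavity, the sine lies above its chord from \<open>0\<close> to
  \<open>pi / 2\<close>.\<close>

lemma sin_ge_linear:
  assumes "0 \<le> v" "v \<le> 1"
  shows "v \<le> sin (pi / 2 * v)"
proof -
  have "convex_on {0..pi} (\<lambda>x. - sin x)"
    by (rule f''_ge0_imp_convex[where f' = "\<lambda>x. - cos x" and f'' = sin])
       (auto intro!: derivative_eq_intros sin_ge_zero)
  from convex_onD[OF this assms, of 0 "pi / 2"] show ?thesis
    by (simp add: mult.commute)
qed

lemma sin_diff_le:
  fixes a b :: real
  assumes "a \<le> b"
  shows "sin b - sin a \<le> b - a"
proof -
  have "sin b - sin a = 2 * (sin ((b - a) / 2) * cos ((b + a) / 2))"
    by (simp add: sin_diff_sin)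
  also have "\<dots> \<le> 2 * \<bar>sin ((b - a) / 2)\<bar> * \<bar>cos ((b + a) / 2)\<bar>"
    by (metis abs_ge_self abs_mult abs_numeral mult.assoc)
  also have "\<dots> \<le> 2 * \<bar>sin ((b - a) / 2)\<bar> * 1"
    by (intro mult_left_mono) auto
  also have "\<dots> \<le> 2 * ((b - a) / 2)"
    using abs_sin_x_le_abs_x[of "(b - a) / 2"] assms by simp
  finally show ?thesis
    by simp
qed

lemma kink_height_decreasing_right:
  assumes "0 \<le> \<psi>" "\<psi> < \<psi>'" "\<psi>' \<le> pi / 2"
  shows "kink_height \<psi>' < kink_height \<psi>"
proof -
  define u v where "u = 2 * \<psi> / pi" and "v = 2 * \<psi>' / pi"
  have uv: "0 \<le> u" "u < v"
    using assms by (auto simp: u_def v_def divide_strict_right_mono)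
  have \<psi>: "\<psi> = pi / 2 * u" "\<psi>' = pi / 2 * v"
    by (auto simp: u_def v_def)
  have height: "kink_height \<psi> = (1 - u\<^sup>2) / 4 + u * sin \<psi> / 10" "kink_height \<psi>' = (1 - v\<^sup>2) / 4 + v * sin \<psi>' / 10"
    using assms uv kink_param_mid[of \<psi>] kink_param_mid[of \<psi>']
      kink_height_nonneg_param[of \<psi>] kink_height_nonneg_param[of \<psi>'] by (simp_all add: u_def v_def)
  have "v * sin \<psi>' - u * sin \<psi> = (v - u) * sin \<psi>' + u * (sin \<psi>' - sin \<psi>)"
    by (simp add: algebra_simps)
  also have "\<dots> \<le> (v - u) * \<psi>' + u * (\<psi>' - \<psi>)"
    using uv assms by (intro add_mono mult_left_mono sin_x_le_x sin_diff_le) auto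
  also have "\<dots> = pi / 2 * (v\<^sup>2 - u\<^sup>2)"
    by (simp add: \<psi> power2_eq_square field_simps)
  \<comment> \<open>The factor 5/2 times the slope 1/10 is 1/4, the coefficient of the quadratic
    term, so the quadratic decrease wins.\<close>
  also have "\<dots> < 5 / 2 * (v\<^sup>2 - u\<^sup>2)"
    using uv pi_less_4 by (intro mult_strict_right_mono) (auto simp: power_strict_mono)
  finally show ?thesis
    unfolding height by (simp add: field_simps)
qed

lemma kink_height_decreasing_left:
  assumes "- pi / 2 \<le> \<psi>" "\<psi> < \<psi>'" "\<psi>' \<le> 0"
  shows "kink_height \<psi>' < kink_height \<psi>"
proof -
  \<comment> \<open>The reflection moves both parameters into \<open>[0, 1]\<close> and exchanges
    their order. The quadratic term now works against the claim, and the slope 1/2 is what outweighs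
    it.\<close>
  define u v where "u = - 2 * \<psi>' / pi" and "v = - 2 * \<psi> / pi"
  have uv: "0 \<le> u" "u < v" "v \<le> 1"
    using assms by (auto simp: u_def v_def divide_strict_right_mono field_simps)
  have \<psi>: "\<psi>' = - (pi / 2 * u)" "\<psi> = - (pi / 2 * v)"
    by (auto simp: u_def v_def)
  have param: "kink_param \<psi>' = - u" "kink_param \<psi> = - v"
    using assms by (auto simp: kink_param_mid u_def v_def)
  have height: "kink_height \<psi>' = (1 - u\<^sup>2) / 4 + u * sin (pi / 2 * u) / 2"
      "kink_height \<psi> = (1 - v\<^sup>2) / 4 + v * sin (pi / 2 * v) / 2"
    using uv param kink_height_nonpos_param[of \<psi>] kink_height_nonpos_param[of \<psi>']
    unfolding \<psi> by simp_all
  have "- (pi / 2) \<le> pi / 2 * u" "pi / 2 * u \<le> pi / 2 * v" "pi / 2 * v \<le> pi / 2"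
    using uv pi_gt_zero by (auto simp del: pi_gt_zero intro: order_trans[of _ 0])
  then have sin_mono: "sin (pi / 2 * u) \<le> sin (pi / 2 * v)"
    by (rule sin_monotone_2pi_le)
  have "v\<^sup>2 - u\<^sup>2 = (v - u) * (u + v)"
    by (simp add: power2_eq_square algebra_simps)
  also have "\<dots> < (v - u) * (2 * v)"
    using uv by (intro mult_strict_left_mono) auto
  also have "\<dots> \<le> (v - u) * (2 * sin (pi / 2 * v))"
    using uv sin_ge_linear[of v] by (intro mult_left_mono) auto
  also have "\<dots> \<le> (v - u) * (2 * sin (pi / 2 * v)) + 2 * (u * (sin (pi / 2 * v) - sin (pi / 2 * u)))"
    using uv(1) sin_mono by simp
  also have "\<dots> = 2 * (v * sin (pi / 2 * v) - u * sin (pi / 2 * u))"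
    by (simp add: algebra_simps)
  finally show ?thesis
    unfolding height by (simp add: field_simps)
qed

lemma kink_height_ge: "pi / 2 \<le> \<psi> \<Longrightarrow> kink_height \<psi> = sin \<psi> / 10"
  and kink_height_le: "\<psi> \<le> - pi / 2 \<Longrightarrow> kink_height \<psi> = - sin \<psi> / 2"
  by (simp_all add: kink_height_def kink_param_ge kink_param_le)

text \<open>On this arc the height is a multiple of the sine, written as a cosine shifted by
  \<open>pi / 2\<close> to use monotonicity of the cosine.\<close>

lemma kink_height_decreasing_end:
  assumes "pi / 2 \<le> \<psi>" "\<psi> < \<psi>'" "\<psi>' \<le> pi"
  shows "kink_height \<psi>' < kink_height \<psi>"
  using assms cos_monotone_0_pi[of "\<psi> - pi / 2" "\<psi>' - pi / 2"]
  by (simp add: kink_height_ge cos_diff)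

lemma kink_height_decreasing:
  assumes "- pi / 2 \<le> \<psi>" "\<psi> < \<psi>'" "\<psi>' \<le> pi"
  shows "kink_height \<psi>' < kink_height \<psi>"
proof -
  have right: "kink_height b < kink_height a" if "0 \<le> a" "a < b" "b \<le> pi" for a b
  proof -
    consider "b \<le> pi / 2" | "pi / 2 \<le> a" | "a < pi / 2" "pi / 2 < b"
      by linarith
    then show ?thesis
    proof cases
      case 3
      then show ?thesis
        using kink_height_decreasing_right[of a "pi / 2"] kink_height_decreasing_end[of "pi / 2" b] that
        by auto
    qed (use that kink_height_decreasing_right kink_height_decreasing_end in auto)
  qed
  consider "\<psi>' \<le> 0" | "0 \<le> \<psi>" | "\<psi> < 0" "0 < \<psi>'"
    by linarith
  then show ?thesis
  proof cases
    case 3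
    then show ?thesis
      using kink_height_decreasing_left[of \<psi> 0] right[of 0 \<psi>'] assms by auto
  qed (use assms kink_height_decreasing_left right in auto)
qed

lemma kink_height_end: "kink_height pi = 0" "kink_height (- pi) = 0"
  by (simp_all add: kink_height_ge kink_height_le)

text \<open>Up to \<open>- pi / 2\<close> the sign of the sine decides; beyond it the height
  decreases strictly to its value 0 at \<open>pi\<close>.\<close>

lemma kink_height_pos:
  assumes "\<bar>\<psi>\<bar> < pi"
  shows "0 < kink_height \<psi>"
proof (cases "\<psi> \<le> - pi / 2")
  case True
  then show ?thesis
    using assms sin_gt_zero[of "- \<psi>"] by (simp add: kink_height_le abs_less_iff)
next
  case False
  then show ?thesis
    using assms kink_height_decreasing[of \<psi> pi] by (simp add: kink_height_end)
qed

section \<open>Injectivity of the projection along the \<open>x\<close>-axis\<close>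

text \<open>By monotonicity of the height only the outer arc could meet another part of the same
  half, and the sign of the cosine leaves only the inner arc. These arcs project to quarters of
  nested ellipses, with semiaxes 2, 1/2 and 1, 1/10.\<close>

lemma kink_projection_inj_aux:
  assumes "- pi \<le> \<psi>" "\<psi> < \<psi>'" "\<psi>' \<le> pi"
    and Y: "kink_radius \<psi> * cos \<psi> = kink_radius \<psi>' * cos \<psi>'"
    and Z: "kink_height \<psi> = kink_height \<psi>'"
  shows False
proof -
  have "\<psi> < - pi / 2"
    using kink_height_decreasing[of \<psi> \<psi>'] assms by fastforce
  then have big: "kink_radius \<psi> = 2"
    by (simp add: kink_radius_def kink_param_le)
  have "- pi / 2 < \<psi>'"
  proof (rule ccontr)
    assume "\<not> - pi / 2 < \<psi>'"
    then have "kink_radius \<psi>' = 2"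
      by (simp add: kink_radius_def kink_param_le)
    then show False
      using Y big cos_monotone_minus_pi_0[of \<psi>' \<psi>] cos_monotone_minus_pi_0[of \<psi> \<psi>']
        assms(1,2) \<open>\<not> - pi / 2 < \<psi>'\<close> pi_ge_two by simp
  qed
  have "cos \<psi> < 0"
    using assms(1) \<open>\<psi> < - pi / 2\<close> cos_gt_zero_pi[of "\<psi> + pi"] by simp
  then have "cos \<psi>' < 0"
    using Y big kink_radius_pos[of \<psi>'] by (smt (verit) zero_le_mult_iff)
  then have "pi / 2 < \<psi>'"
    using \<open>- pi / 2 < \<psi>'\<close> cos_ge_zero[of \<psi>'] by fastforce
  then have "2 * cos \<psi> = cos \<psi>'" "- 5 * sin \<psi> = sin \<psi>'"
    using Y Z big \<open>\<psi> < - pi / 2\<close> by (auto simp: kink_radius_def kink_param_ge kink_height_ge kink_height_le)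
  \<comment> \<open>Disjointness of the two ellipses: the left-hand side is at least 4.\<close>
  then have "(2 * cos \<psi>)\<^sup>2 + (- 5 * sin \<psi>)\<^sup>2 = 1"
    by simp
  then have "4 + 21 * (sin \<psi>)\<^sup>2 = 1"
    by (simp add: power_mult_distrib cos_squared_eq)
  then show False
    using zero_le_power2[of "sin \<psi>"] by linarith
qed

lemma kink_projection_inj:
  assumes "\<bar>\<psi>\<bar> \<le> pi" "\<bar>\<psi>'\<bar> \<le> pi"
    and "kink_radius \<psi> * cos \<psi> = kink_radius \<psi>' * cos \<psi>'" "kink_height \<psi> = kink_height \<psi>'"
  shows "\<psi> = \<psi>'"
proof (rule linorder_cases[of \<psi> \<psi>'])
  assume "\<psi> < \<psi>'"
  then show ?thesis
    using kink_projection_inj_aux[of \<psi> \<psi>'] assms by (simp add: abs_le_iff)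
next
  assume "\<psi>' < \<psi>"
  then show ?thesis
    using kink_projection_inj_aux[of \<psi>' \<psi>] assms by (simp add: abs_le_iff)
qed simp

text \<open>The height is nonnegative and vanishes only at the end points, so the signed height
  determines the half \<open>e\<close> except where the halves are joined.\<close>

lemma signed_kink_height_eq:
  assumes "e \<in> {- 1, 1}" "e' \<in> {- 1, 1}" "\<bar>\<psi>\<bar> \<le> pi" "\<bar>\<psi>'\<bar> \<le> pi"
    and "e * kink_height \<psi> = e' * kink_height \<psi>'"
  shows "kink_height \<psi> = kink_height \<psi>'" "e = e' \<or> \<bar>\<psi>\<bar> = pi"
proof -
  have nonneg: "0 \<le> kink_height x" if "\<bar>x\<bar> \<le> pi" for x
  proof (cases "\<bar>x\<bar> = pi")
    case True
    then have "x = pi \<or> x = - pi"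
      by linarith
    then show ?thesis
      using kink_height_end by auto
  next
    case False
    then show ?thesis
      using kink_height_pos[of x] that by simp
  qed
  show "kink_height \<psi> = kink_height \<psi>'" "e = e' \<or> \<bar>\<psi>\<bar> = pi"
    using assms nonneg[of \<psi>] nonneg[of \<psi>'] kink_height_pos[of \<psi>] by auto
qed

lemma sin_half_inj:
  fixes \<psi> :: real
  assumes "\<bar>\<psi>\<bar> \<le> pi" "\<bar>\<psi>'\<bar> \<le> pi" "sin (\<psi> / 2) = sin (\<psi>' / 2)"
  shows "\<psi> = \<psi>'"
  using sin_inj_pi[of "\<psi> / 2" "\<psi>' / 2"] assms by (auto simp: abs_le_iff)

lemma continuous_on_vector_3:
  fixes a b c :: "'a::topological_space \<Rightarrow> real"
  assumes "continuous_on S a" "continuous_on S b" "continuous_on S c"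
  shows "continuous_on S (\<lambda>x. vector [a x, b x, c x] :: real^3)"
proof -
  have "(vector [p, q, r] :: real^3) = p *\<^sub>R axis 1 1 + q *\<^sub>R axis 2 1 + r *\<^sub>R axis 3 1" for p q r
    by (simp add: vec_eq_iff forall_3 axis_def vector_3)
  then show ?thesis
    using assms by (simp add: continuous_on_add continuous_on_scaleR)
qed

section \<open>The four shears from the kink to the circle\<close>

text \<open>Coordinates 3, 1, 2, 3 are changed in turn. Each shear is admissible because points that
  agree in the other two coordinates are displaced equally.\<close>

lemma ambient_isotopic_kink_circle:
  defines "S \<equiv> {- 1, 1} \<times> {- pi..pi}"
  shows "ambient_isotopic
    ((\<lambda>(e, \<psi>). vector [e * (kink_radius \<psi> * sin \<psi>), kink_radius \<psi> * cos \<psi>,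
                        e * ((1 - (kink_param \<psi>)\<^sup>2) / 4)]) ` S)
    ((\<lambda>(e, \<psi>). vector [sin (\<psi> / 2), e * cos (\<psi> / 2), 0]) ` S)"
    (is "ambient_isotopic (?c0 ` S) (?c4 ` S)")
proof -
  define c1 :: "real \<times> real \<Rightarrow> real^3" where
    "c1 = (\<lambda>(e, \<psi>). vector [e * (kink_radius \<psi> * sin \<psi>), kink_radius \<psi> * cos \<psi>, e * kink_height \<psi>])"
  define c2 :: "real \<times> real \<Rightarrow> real^3" where
    "c2 = (\<lambda>(e, \<psi>). vector [sin (\<psi> / 2), kink_radius \<psi> * cos \<psi>, e * kink_height \<psi>])"
  define c3 :: "real \<times> real \<Rightarrow> real^3" where
    "c3 = (\<lambda>(e, \<psi>). vector [sin (\<psi> / 2), e * cos (\<psi> / 2), e * kink_height \<psi>])"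
  have "compact S"
    unfolding S_def by (intro compact_Times) auto
  have S: "e \<in> {- 1, 1}" "\<bar>\<psi>\<bar> \<le> pi" if "(e, \<psi>) \<in> S" for e \<psi>
    using that by (auto simp: S_def)
  have [continuous_intros]: "continuous_on S (\<lambda>s. kink_param (snd s))" "continuous_on S (\<lambda>s. kink_height (snd s))"
    by (rule continuous_on_compose2[OF continuous_on_kink_param[of UNIV]]
          continuous_on_compose2[OF continuous_on_kink_height[of UNIV]]; auto intro: continuous_intros)+
  have cont: "continuous_on S ?c0" "continuous_on S c1" "continuous_on S c2" "continuous_on S c3"
      "continuous_on S ?c4"
    unfolding split_def c1_def c2_def c3_def kink_radius_def
    by (intro continuous_on_vector_3 continuous_intros; simp)+
  \<comment> \<open>The other coordinates determine the radius, hence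
    \<open>kink_param \<psi>\<close>, and also \<open>e * sin \<psi>\<close>; the displacement is a
    function of these two, even at the crossing.\<close>
  have "ambient_isotopic (?c0 ` S) (c1 ` S)"
  proof (rule ambient_isotopic_change_coordinate[where k = 3, OF \<open>compact S\<close> cont(1,2)])
    show "c1 s $ i = ?c0 s $ i" if "i \<noteq> 3" for s i
      using that exhaust_3[of i] by (auto simp: c1_def split_def vector_3)
    fix s s' assume "s \<in> S" "s' \<in> S" and eq: "\<And>i. i \<noteq> 3 \<Longrightarrow> ?c0 s $ i = ?c0 s' $ i"
    obtain e \<psi> e' \<psi>' where s: "s = (e, \<psi>)" "s' = (e', \<psi>')"
      by fastforce
    have x: "kink_radius \<psi> * (e * sin \<psi>) = kink_radius \<psi>' * (e' * sin \<psi>')"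
      and y: "kink_radius \<psi> * cos \<psi> = kink_radius \<psi>' * cos \<psi>'"
      using eq[of 1] eq[of 2] by (auto simp: s vector_3 mult_ac)
    have "(kink_radius a * (d * sin a))\<^sup>2 + (kink_radius a * cos a)\<^sup>2 = (kink_radius a)\<^sup>2"
      if "(d, a) \<in> S" for d a
    proof -
      have "(kink_radius a * (d * sin a))\<^sup>2 = (kink_radius a)\<^sup>2 * (sin a)\<^sup>2"
        using S(1)[OF that] by (auto simp: power_mult_distrib)
      then show ?thesis
        by (simp only: power_mult_distrib[of _ "cos a"] sin_cos_squared_add mult_1_right
            flip: distrib_left)
    qed
    then have "(kink_radius \<psi>)\<^sup>2 = (kink_radius \<psi>')\<^sup>2"
      using x y \<open>s \<in> S\<close> \<open>s' \<in> S\<close> unfolding s by metis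
    then have r: "kink_radius \<psi> = kink_radius \<psi>'"
      using kink_radius_pos[of \<psi>] kink_radius_pos[of \<psi>'] by simp
    then have "kink_param \<psi> = kink_param \<psi>'"
      by (simp add: kink_radius_def)
    moreover have "e * sin \<psi> = e' * sin \<psi>'"
      using x r kink_radius_pos[of \<psi>'] by simp
    ultimately show "c1 s $ 3 - ?c0 s $ 3 = c1 s' $ 3 - ?c0 s' $ 3"
      by (simp add: s c1_def vector_3 kink_height_def distrib_left flip: mult.assoc)
  qed
  \<comment> \<open>Seen along the \<open>x\<close>-axis the curve is embedded, so its first
    coordinate can be chosen freely; at the joined end points both old and new values are
    independent of \<open>e\<close>.\<close>
  also have "ambient_isotopic (c1 ` S) (c2 ` S)"
  proof (rule ambient_isotopic_change_coordinate[where k = 1, OF \<open>compact S\<close> cont(2,3)])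
    show "c2 s $ i = c1 s $ i" if "i \<noteq> 1" for s i
      using that exhaust_3[of i] by (auto simp: c1_def c2_def split_def vector_3)
    fix s s' assume "s \<in> S" "s' \<in> S" and eq: "\<And>i. i \<noteq> 1 \<Longrightarrow> c1 s $ i = c1 s' $ i"
    obtain e \<psi> e' \<psi>' where s: "s = (e, \<psi>)" "s' = (e', \<psi>')"
      by fastforce
    have y: "kink_radius \<psi> * cos \<psi> = kink_radius \<psi>' * cos \<psi>'"
      and z: "e * kink_height \<psi> = e' * kink_height \<psi>'"
      using eq[of 2] eq[of 3] by (auto simp: s c1_def vector_3)
    have mem: "e \<in> {- 1, 1}" "e' \<in> {- 1, 1}" "\<bar>\<psi>\<bar> \<le> pi" "\<bar>\<psi>'\<bar> \<le> pi"
      using S \<open>s \<in> S\<close> \<open>s' \<in> S\<close> unfolding s by blast+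
    note Z = signed_kink_height_eq[OF mem z]
    have "\<psi> = \<psi>'"
      using kink_projection_inj[OF mem(3,4) y Z(1)] .
    moreover have "sin \<psi> = 0" if "\<bar>\<psi>\<bar> = pi"
    proof -
      have "\<psi> = pi \<or> \<psi> = - pi"
        using that by linarith
      then show ?thesis
        by auto
    qed
    ultimately show "c2 s $ 1 - c1 s $ 1 = c2 s' $ 1 - c1 s' $ 1"
      using Z(2) by (auto simp: s c1_def c2_def vector_3)
  qed
  \<comment> \<open>Now \<open>sin (\<psi> / 2)\<close> determines \<psi>, and the signed height
    determines \<open>e\<close> away from the end points, where \<open>cos (\<psi> / 2)\<close>
    vanishes.\<close>
  also (ambient_isotopic_trans) have "ambient_isotopic (c2 ` S) (c3 ` S)"
  proof (rule ambient_isotopic_change_coordinate[where k = 2, OF \<open>compact S\<close> cont(3,4)])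
    show "c3 s $ i = c2 s $ i" if "i \<noteq> 2" for s i
      using that exhaust_3[of i] by (auto simp: c3_def c2_def split_def vector_3)
    fix s s' assume "s \<in> S" "s' \<in> S" and eq: "\<And>i. i \<noteq> 2 \<Longrightarrow> c2 s $ i = c2 s' $ i"
    obtain e \<psi> e' \<psi>' where s: "s = (e, \<psi>)" "s' = (e', \<psi>')"
      by fastforce
    have x: "sin (\<psi> / 2) = sin (\<psi>' / 2)" and z: "e * kink_height \<psi> = e' * kink_height \<psi>'"
      using eq[of 1] eq[of 3] by (auto simp: s c2_def vector_3)
    have mem: "e \<in> {- 1, 1}" "e' \<in> {- 1, 1}" "\<bar>\<psi>\<bar> \<le> pi" "\<bar>\<psi>'\<bar> \<le> pi"
      using S \<open>s \<in> S\<close> \<open>s' \<in> S\<close> unfolding s by blast+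
    have "\<psi> = \<psi>'"
      using sin_half_inj[OF mem(3,4) x] .
    moreover have "cos (\<psi> / 2) = 0" if "\<bar>\<psi>\<bar> = pi"
    proof -
      have "\<psi> = pi \<or> \<psi> = - pi"
        using that by linarith
      then show ?thesis
        by auto
    qed
    ultimately show "c3 s $ 2 - c2 s $ 2 = c3 s' $ 2 - c2 s' $ 2"
      using signed_kink_height_eq(2)[OF mem z] by (auto simp: s c3_def c2_def vector_3)
  qed
  \<comment> \<open>The curve now lies over the embedded unit circle and can be flattened.\<close>
  also (ambient_isotopic_trans) have "ambient_isotopic (c3 ` S) (?c4 ` S)"
  proof (rule ambient_isotopic_change_coordinate[where k = 3, OF \<open>compact S\<close> cont(4,5)])
    show "?c4 s $ i = c3 s $ i" if "i \<noteq> 3" for s i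
      using that exhaust_3[of i] by (auto simp: c3_def split_def vector_3)
    fix s s' assume "s \<in> S" "s' \<in> S" and eq: "\<And>i. i \<noteq> 3 \<Longrightarrow> c3 s $ i = c3 s' $ i"
    obtain e \<psi> e' \<psi>' where s: "s = (e, \<psi>)" "s' = (e', \<psi>')"
      by fastforce
    have x: "sin (\<psi> / 2) = sin (\<psi>' / 2)" and y: "e * cos (\<psi> / 2) = e' * cos (\<psi>' / 2)"
      using eq[of 1] eq[of 2] by (auto simp: s c3_def vector_3)
    have mem: "e \<in> {- 1, 1}" "e' \<in> {- 1, 1}" "\<bar>\<psi>\<bar> \<le> pi" "\<bar>\<psi>'\<bar> \<le> pi"
      using S \<open>s \<in> S\<close> \<open>s' \<in> S\<close> unfolding s by blast+
    have \<psi>: "\<psi> = \<psi>'"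
      using sin_half_inj[OF mem(3,4) x] .
    have "e = e' \<or> kink_height \<psi> = 0"
    proof (cases "\<bar>\<psi>\<bar> = pi")
      case True
      then have "\<psi> = pi \<or> \<psi> = - pi"
        by linarith
      then show ?thesis
        using kink_height_end by auto
    next
      case False
      then have "0 < cos (\<psi> / 2)"
        using mem(3) by (intro cos_gt_zero_pi) auto
      then show ?thesis
        using y \<psi> by simp
    qed
    then show "?c4 s $ 3 - c3 s $ 3 = ?c4 s' $ 3 - c3 s' $ 3"
      using \<psi> by (auto simp: s c3_def vector_3)
  qed
  finally (ambient_isotopic_trans) show ?thesis .
qed

section \<open>Parametrizations of the two closures\<close>

text \<open>The word has two slots, each a half turn: slot 0 carries the crossing where
  \<open>y\<close> is nonnegative, slot 1 the two parallel arcs on the other side.\<close>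

lemma braid_point_kink:
  "braid_point [1] 0 1 t = vector [(1 + t) * cos (pi * t), (1 + t) * sin (pi * t), t * (1 - t)]"
  "braid_point [1] 0 2 t = vector [(2 - t) * cos (pi * t), (2 - t) * sin (pi * t), - (t * (1 - t))]"
  "braid_point [1] 1 1 t = vector [- cos (pi * t), - sin (pi * t), 0]"
  "braid_point [1] 1 2 t = vector [- 2 * cos (pi * t), - 2 * sin (pi * t), 0]"
proof -
  have "2 * pi * (1 + t) / 2 = pi * t + pi"
    by (simp add: field_simps)
  then show
    "braid_point [1] 0 1 t = vector [(1 + t) * cos (pi * t), (1 + t) * sin (pi * t), t * (1 - t)]"
    "braid_point [1] 0 2 t = vector [(2 - t) * cos (pi * t), (2 - t) * sin (pi * t), - (t * (1 - t))]"
    "braid_point [1] 1 1 t = vector [- cos (pi * t), - sin (pi * t), 0]"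
    "braid_point [1] 1 2 t = vector [- 2 * cos (pi * t), - 2 * sin (pi * t), 0]"
    by (simp_all add: braid_point_def Let_def passing_def slot_perm_def Transposition.transpose_def)
qed

text \<open>Each strand of the crossing is the middle of one half. Each arc of slot 1 is cut at the
  negative \<open>y\<close>-axis, that is at \<open>t = 1/2\<close>, and its pieces go to different
  halves.\<close>

lemma closed_braid_kink:
  "closed_braid 2 [1] =
    (\<lambda>(e, \<psi>). vector [e * (kink_radius \<psi> * sin \<psi>), kink_radius \<psi> * cos \<psi>,
                        e * ((1 - (kink_param \<psi>)\<^sup>2) / 4)]) ` ({- 1, 1} \<times> {- pi..pi})"
    (is "_ = ?c ` _")
proof -
  have mid: "braid_point [1] 0 1 (1 / 2 - \<psi> / pi) = ?c (1, \<psi>)"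
      "braid_point [1] 0 2 (1 / 2 + \<psi> / pi) = ?c (- 1, \<psi>)" if "\<bar>\<psi>\<bar> \<le> pi / 2" for \<psi>
  proof -
    define q where "q = \<psi> / pi"
    have "pi * (1 / 2 - q) = pi / 2 - \<psi>" "pi * (1 / 2 + q) = \<psi> + pi / 2"
      by (simp_all add: q_def field_simps)
    then show "braid_point [1] 0 1 (1 / 2 - \<psi> / pi) = ?c (1, \<psi>)"
        "braid_point [1] 0 2 (1 / 2 + \<psi> / pi) = ?c (- 1, \<psi>)"
      using kink_param_mid[OF that] unfolding braid_point_kink times_divide_eq_right[symmetric] q_def[symmetric]
      by (simp_all add: vec_eq_iff forall_3 vector_3 kink_radius_def cos_diff sin_diff cos_add sin_add
          power2_eq_square algebra_simps)
  qed
  have right: "braid_point [1] 1 1 (3 / 2 - \<psi> / pi) = ?c (1, \<psi>)"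
      "braid_point [1] 1 1 (\<psi> / pi - 1 / 2) = ?c (- 1, \<psi>)" if "pi / 2 \<le> \<psi>" for \<psi>
  proof -
    have angle: "pi * (3 / 2 - \<psi> / pi) = pi + (pi / 2 - \<psi>)" "pi * (\<psi> / pi - 1 / 2) = \<psi> - pi / 2"
      by (simp_all add: field_simps)
    show "braid_point [1] 1 1 (3 / 2 - \<psi> / pi) = ?c (1, \<psi>)"
        "braid_point [1] 1 1 (\<psi> / pi - 1 / 2) = ?c (- 1, \<psi>)"
      using kink_param_ge[OF that] unfolding braid_point_kink angle cos_add sin_add
      by (simp_all add: vec_eq_iff forall_3 vector_3 kink_radius_def cos_diff sin_diff)
  qed
  have left: "braid_point [1] 1 2 (- 1 / 2 - \<psi> / pi) = ?c (1, \<psi>)"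
      "braid_point [1] 1 2 (3 / 2 + \<psi> / pi) = ?c (- 1, \<psi>)" if "\<psi> \<le> - pi / 2" for \<psi>
  proof -
    have angle: "pi * (- 1 / 2 - \<psi> / pi) = - (\<psi> + pi / 2)" "pi * (3 / 2 + \<psi> / pi) = pi + (\<psi> + pi / 2)"
      by (simp_all add: field_simps)
    show "braid_point [1] 1 2 (- 1 / 2 - \<psi> / pi) = ?c (1, \<psi>)"
        "braid_point [1] 1 2 (3 / 2 + \<psi> / pi) = ?c (- 1, \<psi>)"
      using kink_param_le[OF that] unfolding braid_point_kink angle cos_minus sin_minus cos_add sin_add
      by (simp_all add: vec_eq_iff forall_3 vector_3 kink_radius_def)
  qed
  have braid: "closed_braid 2 [1] = (\<Union>j\<in>{0, 1}. \<Union>p\<in>{1, 2}. braid_point [1] j p ` {0..1})"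
  proof -
    have "{0..length [1::nat]} = {0, 1}" "{1..2::nat} = {1, 2}"
      by auto
    then show ?thesis
      by (simp only: closed_braid_def)
  qed
  have fwd: "braid_point [1] j p t \<in> ?c ` ({- 1, 1} \<times> {- pi..pi})"
    if jpt: "j \<in> {0, 1}" "p \<in> {1, 2}" "t \<in> {0..1}" for j p t
  proof -
    define a where "a = pi * t"
    have a: "0 \<le> a" "a \<le> pi" and t: "a / pi = t"
      using jpt(3) by (auto simp: a_def intro: mult_left_le)
    consider "j = 0" "p = 1" | "j = 0" "p = 2" | "j = 1" "p = 1" | "j = 1" "p = 2"
      using jpt(1,2) by blast
    then show ?thesis
    proof cases
      case 1
      have "braid_point [1] j p t = ?c (1, pi / 2 - a)"
        using mid(1)[of "pi / 2 - a"] a t unfolding 1 abs_le_iff by (simp add: diff_divide_distrib)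
      then show ?thesis
        by (rule image_eqI) (use a in auto)
    next
      case 2
      have "braid_point [1] j p t = ?c (- 1, a - pi / 2)"
        using mid(2)[of "a - pi / 2"] a t unfolding 2 abs_le_iff by (simp add: diff_divide_distrib)
      then show ?thesis
        by (rule image_eqI) (use a in auto)
    next
      case 3
      \<comment> \<open>Both formulas hold along the whole arc; the case distinction picks the one
        whose parameter stays in \<open>[- pi, pi]\<close>.\<close>
      have 1: "braid_point [1] j p t = ?c (- 1, a + pi / 2)"
        using right(2)[of "a + pi / 2"] a t unfolding 3 by (simp add: add_divide_distrib)
      have 2: "braid_point [1] j p t = ?c (1, 3 / 2 * pi - a)"
        using right(1)[of "3 / 2 * pi - a"] a t unfolding 3 by (simp add: diff_divide_distrib)
      show ?thesis
      proof (cases "a \<le> pi / 2")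
        case True
        show ?thesis
          using 1 by (rule image_eqI) (use a True in auto)
      next
        case False
        show ?thesis
          using 2 by (rule image_eqI) (use a False in auto)
      qed
    next
      case 4
      have 1: "braid_point [1] j p t = ?c (1, - pi / 2 - a)"
        using left(1)[of "- pi / 2 - a"] a t unfolding 4 by (simp add: diff_divide_distrib)
      have 2: "braid_point [1] j p t = ?c (- 1, a - 3 / 2 * pi)"
        using left(2)[of "a - 3 / 2 * pi"] a t unfolding 4 by (simp add: diff_divide_distrib)
      show ?thesis
      proof (cases "a \<le> pi / 2")
        case True
        show ?thesis
          using 1 by (rule image_eqI) (use a True in auto)
      next
        case False
        show ?thesis
          using 2 by (rule image_eqI) (use a False in auto)
      qed
    qed
  qed
  have bwd: "?c (e, \<psi>) \<in> closed_braid 2 [1]" if "e \<in> {- 1, 1}" "- pi \<le> \<psi>" "\<psi> \<le> pi" for e \<psi>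
  proof -
    have q: "- 1 \<le> \<psi> / pi" "\<psi> / pi \<le> 1"
      using that by (simp_all add: field_simps)
    have pts: "braid_point [1] j p t \<in> closed_braid 2 [1]"
      if "j \<in> {0, 1}" "p \<in> {1, 2}" "0 \<le> t" "t \<le> 1" for j p t
      using that unfolding braid by (intro UN_I[of j] UN_I[of p] imageI) auto
    consider "\<psi> \<le> - pi / 2" | "\<bar>\<psi>\<bar> \<le> pi / 2" | "pi / 2 \<le> \<psi>"
      by linarith
    then show ?thesis
    proof cases
      case 1
      then have "\<psi> / pi \<le> - 1 / 2"
        by (simp add: field_simps)
      then have "braid_point [1] 1 2 (- 1 / 2 - \<psi> / pi) \<in> closed_braid 2 [1]"
          "braid_point [1] 1 2 (3 / 2 + \<psi> / pi) \<in> closed_braid 2 [1]"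
        using q by (intro pts; (linarith | simp))+
      then show ?thesis
        using \<open>e \<in> {- 1, 1}\<close> unfolding left[OF 1] by blast
    next
      case 2
      then have "- 1 / 2 \<le> \<psi> / pi" "\<psi> / pi \<le> 1 / 2"
        by (simp_all add: field_simps abs_le_iff)
      then have "braid_point [1] 0 1 (1 / 2 - \<psi> / pi) \<in> closed_braid 2 [1]"
          "braid_point [1] 0 2 (1 / 2 + \<psi> / pi) \<in> closed_braid 2 [1]"
        using q by (intro pts; (linarith | simp))+
      then show ?thesis
        using \<open>e \<in> {- 1, 1}\<close> unfolding mid[OF 2] by blast
    next
      case 3
      then have "1 / 2 \<le> \<psi> / pi"
        by (simp add: field_simps)
      then have "braid_point [1] 1 1 (3 / 2 - \<psi> / pi) \<in> closed_braid 2 [1]"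
          "braid_point [1] 1 1 (\<psi> / pi - 1 / 2) \<in> closed_braid 2 [1]"
        using q by (intro pts; (linarith | simp))+
      then show ?thesis
        using \<open>e \<in> {- 1, 1}\<close> unfolding right[OF 3] by blast
    qed
  qed
  show ?thesis
  proof (rule subset_antisym)
    show "closed_braid 2 [1] \<subseteq> ?c ` ({- 1, 1} \<times> {- pi..pi})"
      unfolding braid by (intro UN_least image_subsetI fwd)
    show "?c ` ({- 1, 1} \<times> {- pi..pi}) \<subseteq> closed_braid 2 [1]"
    proof (rule image_subsetI)
      fix s :: "real \<times> real"
      assume "s \<in> {- 1, 1} \<times> {- pi..pi}"
      then show "?c s \<in> closed_braid 2 [1]"
        using bwd[of "fst s" "snd s"] by (cases s) simp
    qed
  qed
qed

text \<open>The empty word has a single slot, a full turn. The angle \<open>\<psi> / 2\<close> is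
  measured from the \<open>y\<close>-axis, and \<open>e\<close> selects the upper or lower
  semicircle.\<close>

lemma closed_braid_circle:
  "closed_braid 1 [] = (\<lambda>(e, \<psi>). vector [sin (\<psi> / 2), e * cos (\<psi> / 2), 0]) ` ({- 1, 1} \<times> {- pi..pi})"
    (is "_ = ?c ` _")
proof -
  define b :: "real \<Rightarrow> real^3" where "b = (\<lambda>t. vector [cos (2 * pi * t), sin (2 * pi * t), 0])"
  have braid: "closed_braid 1 [] = b ` {0..1}"
    by (simp add: closed_braid_def braid_point_def b_def passing_def slot_perm_def Let_def)
  have eq: "b (1 / 4 - \<psi> / (4 * pi)) = ?c (1, \<psi>)" "b (3 / 4 + \<psi> / (4 * pi)) = ?c (- 1, \<psi>)" for \<psi>
  proof -
    have angle: "2 * pi * (1 / 4 - \<psi> / (4 * pi)) = pi / 2 - \<psi> / 2"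
      "2 * pi * (3 / 4 + \<psi> / (4 * pi)) = pi + (\<psi> / 2 + pi / 2)"
      by (simp_all add: field_simps)
    show "b (1 / 4 - \<psi> / (4 * pi)) = ?c (1, \<psi>)" "b (3 / 4 + \<psi> / (4 * pi)) = ?c (- 1, \<psi>)"
      unfolding b_def angle cos_add sin_add by (simp_all add: cos_diff sin_diff)
  qed
  have fwd: "b t \<in> ?c ` ({- 1, 1} \<times> {- pi..pi})" if "t \<in> {0..1}" for t
  proof (cases "t \<le> 1 / 2")
    case True
    have bound: "pi * t \<le> pi * (1 / 2)" "0 \<le> pi * t"
      using True that by (intro mult_left_mono mult_nonneg_nonneg; simp)+
    have "b t = ?c (1, pi - 4 * pi * t)"
      using eq(1)[of "pi - 4 * pi * t"] by (simp add: diff_divide_distrib)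
    then show ?thesis
      by (rule image_eqI) (use bound in auto)
  next
    case False
    have bound: "pi * (1 / 2) \<le> pi * t" "pi * t \<le> pi * 1"
      using False that by (intro mult_left_mono; simp)+
    have "b t = ?c (- 1, 4 * pi * t - 3 * pi)"
      using eq(2)[of "4 * pi * t - 3 * pi"] by (simp add: diff_divide_distrib)
    then show ?thesis
      by (rule image_eqI) (use bound in auto)
  qed
  have bwd: "?c (e, \<psi>) \<in> b ` {0..1}" if "e \<in> {- 1, 1}" "- pi \<le> \<psi>" "\<psi> \<le> pi" for e \<psi>
  proof -
    have "- 1 / 4 \<le> \<psi> / (4 * pi)" "\<psi> / (4 * pi) \<le> 1 / 4"
      using that by (simp_all add: field_simps)
    then have "b (1 / 4 - \<psi> / (4 * pi)) \<in> b ` {0..1}" "b (3 / 4 + \<psi> / (4 * pi)) \<in> b ` {0..1}"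
      by (intro imageI; unfold atLeastAtMost_iff; linarith)+
    then show ?thesis
      using that(1) unfolding eq by blast
  qed
  show ?thesis
    unfolding braid
  proof (rule subset_antisym)
    show "b ` {0..1} \<subseteq> ?c ` ({- 1, 1} \<times> {- pi..pi})"
      by (intro image_subsetI fwd)
    show "?c ` ({- 1, 1} \<times> {- pi..pi}) \<subseteq> b ` {0..1}"
    proof (rule image_subsetI)
      fix s :: "real \<times> real"
      assume "s \<in> {- 1, 1} \<times> {- pi..pi}"
      then show "?c s \<in> b ` {0..1}"
        using bwd[of "fst s" "snd s"] by (cases s) simp
    qed
  qed
qed

section \<open>Non-split alternating closed braids\<close>

lemma ambient_isotopic_circle_torus_link_2: "ambient_isotopic (closed_braid 1 []) (torus_link_2 1)"
  using ambient_isotopic_sym[OF ambient_isotopic_kink_circle]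
  by (simp add: torus_link_2_def closed_braid_kink[simplified] closed_braid_circle[simplified])

text \<open>Every generator must occur, since a missing one gives a splitting sphere, but the
  letters 1 and 2 cannot both occur; hence there are at most two strands.\<close>

lemma non_split_alternating_closed_braid:
  assumes w: "positive_braid_word N w" "alternating_closed_braid N w"
    and "\<not> split_link (closed_braid N w)"
  shows "N = 1 \<and> w = [] \<or> N = 2 \<and> w \<noteq> [] \<and> w = replicate (length w) 1"
proof -
  have letters: "i \<in> set w" if "1 \<le> i" "i < N" for i
    using split_link_closed_braid that assms(3) by blast
  have "N \<le> 2"
  proof (rule ccontr)
    assume "\<not> N \<le> 2"
    then show False
      using letters[of 1] letters[of 2] alternating_not_both_adjacent_letters[OF w, of 1]
      by (simp add: numeral_2_eq_2)
  qed
  then consider "N = 1" | "N = 2"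
    using w(1) by (fastforce simp: positive_braid_word_def)
  then show ?thesis
  proof cases
    case 1
    then have "w = []"
      using w(1) by (cases w) (auto simp: positive_braid_word_def)
    with 1 show ?thesis
      by simp
  next
    case 2
    then have "\<forall>i\<in>set w. i = 1"
      using w(1) by (fastforce simp: positive_braid_word_def)
    then have "replicate (length w) 1 = w"
      by (simp add: replicate_length_same)
    moreover have "w \<noteq> []"
      using letters[of 1] 2 by auto
    ultimately show ?thesis
      using 2 by simp
  qed
qed

theorem corollary7p2:
  fixes L :: "(real^3) set"
  assumes "link L"
    and "\<not> split_link L"
    and "admits_alternating_positive_closed_braid_diagram L"
  shows "connected_sum_of_torus_links_2 L"
proof -
  obtain N w where w: "positive_braid_word N w" "alternating_closed_braid N w"
    and iso: "ambient_isotopic L (closed_braid N w)"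
    using assms(3) unfolding admits_alternating_positive_closed_braid_diagram_def by blast
  \<comment> \<open>A splitting sphere of the closure would be carried to one of \<open>L\<close> by
    the reversed isotopy.\<close>
  have "\<not> split_link (closed_braid N w)"
    using assms(2) split_link_ambient_isotopic[OF ambient_isotopic_sym[OF iso]] by blast
  from non_split_alternating_closed_braid[OF w this] show ?thesis
  proof (elim disjE conjE)
    assume "N = 1" "w = []"
    then have "ambient_isotopic L (torus_link_2 1)"
      using ambient_isotopic_trans[OF _ ambient_isotopic_circle_torus_link_2] iso by blast
    then show ?thesis
      by (rule torus[rotated]) simp
  next
    assume "N = 2" "w \<noteq> []" "w = replicate (length w) 1"
    then have "ambient_isotopic L (torus_link_2 (length w))"
      using iso by (simp add: torus_link_2_def)
    then show ?thesis
      by (rule torus[rotated]) (use \<open>w \<noteq> []\<close> in \<open>simp add: Suc_le_eq\<close>)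
  qed
qed

end
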